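(* Let $X$ be a compact metric space and let $f\colon X\to X$ be a continuum-expansive homeomorphism. Then $f$ is tight.
   Context: A continuum is a compact connected (subset of a) metric space; a set is non-degenerate if it contains more than one point. A homeomorphism $f\colon X\to X$ of a metric space is continuum-expansive if there is $\varepsilon>0$ such that every (nonempty) continuum $C\subset X$ satisfying $\operatorname{diam} f^n(C)\le\varepsilon$ for every $n\in\mathbb Z$ is a single point. Entropy of compact sets (Bowen). Let $(X,d)$ be a compact metric space, $f\colon X\to X$ a homeomorphism, and $d_n(x,y)=\max\{d(f^i(x),f^i(y)) : 0\le i<n\}$. A set $E$ is $(n,\varepsilon)$-separated if $d_n(x,y)>\varepsilon$ for all distinct $x,y\in E$; a set $F$ $(n,\varepsilon)$-spans $K$ if for every $x\in K$ there is $y\in F$ with $d_n(x,y)\le\varepsilon$. For compact $K\subset X$ let $r(n,\varepsilon,K)$ be the minimal cardinality of a set that $(n,\varepsilon)$-spans $K$, and $s(n,\varepsilon,K)$ the maximal cardinality of an $(n,\varepsilon)$-separated subset of $K$. Then $$h(f,K)=\lim_{\varepsilon\to0}\limsup_{n\to\infty}\tfrac1n\ln r(n,\varepsilon,K)=\lim_{\varepsilon\to0}\limsup_{n\to\infty}\tfrac1n\ln s(n,\varepsilon,K).$$ The set $K$ need not be invariant. Put $h_\pm(K)=\max\{h(f,K),h(f^{-1},K)\}$. The homeomorphism $f$ is tight if $h_\pm(C)>0$ for every non-degenerate continuum $C\subset X$. *)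

theory Defs
  imports "HOL-Analysis.Analysis"
begin

text \<open>
  The compact metric space is a compact subset \<open>X\<close> of a type of class \<open>metric_space\<close>; a
  homeomorphism \<open>f\<close> of \<open>X\<close> only matters on \<open>X\<close>, and its inverse is \<open>inv_into X f\<close>.
\<close>

definition continuum :: "'a::metric_space set \<Rightarrow> bool" where
  "continuum C \<longleftrightarrow> C \<noteq> {} \<and> compact C \<and> connected C"

definition nondegenerate :: "'a set \<Rightarrow> bool" where
  "nondegenerate C \<longleftrightarrow> (\<exists>x\<in>C. \<exists>y\<in>C. x \<noteq> y)"

definition int_iterate :: "'a set \<Rightarrow> ('a \<Rightarrow> 'a) \<Rightarrow> int \<Rightarrow> 'a \<Rightarrow> 'a" where
  "int_iterate X f n = (if n \<ge> 0 then f ^^ nat n else inv_into X f ^^ nat (- n))"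

definition continuum_expansive :: "'a::metric_space set \<Rightarrow> ('a \<Rightarrow> 'a) \<Rightarrow> bool" where
  "continuum_expansive X f \<longleftrightarrow>
     (\<exists>\<epsilon>>0. \<forall>C\<subseteq>X. continuum C \<and> (\<forall>n::int. diameter (int_iterate X f n ` C) \<le> \<epsilon>)
        \<longrightarrow> (\<exists>x. C = {x}))"

text \<open>Only used for \<open>n > 0\<close>; the value for \<open>n = 0\<close> is irrelevant to the limits below.\<close>

definition bowen_dist :: "('a::metric_space \<Rightarrow> 'a) \<Rightarrow> nat \<Rightarrow> 'a \<Rightarrow> 'a \<Rightarrow> real" where
  "bowen_dist f n x y = Max ((\<lambda>i. dist ((f ^^ i) x) ((f ^^ i) y)) ` {..<n})"

definition separated :: "('a::metric_space \<Rightarrow> 'a) \<Rightarrow> nat \<Rightarrow> real \<Rightarrow> 'a set \<Rightarrow> bool" where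
  "separated f n \<epsilon> E \<longleftrightarrow> (\<forall>x\<in>E. \<forall>y\<in>E. x \<noteq> y \<longrightarrow> bowen_dist f n x y > \<epsilon>)"

definition spans :: "('a::metric_space \<Rightarrow> 'a) \<Rightarrow> nat \<Rightarrow> real \<Rightarrow> 'a set \<Rightarrow> 'a set \<Rightarrow> bool" where
  "spans f n \<epsilon> F K \<longleftrightarrow> (\<forall>x\<in>K. \<exists>y\<in>F. bowen_dist f n x y \<le> \<epsilon>)"

text \<open>
  Spanning sets are taken in \<open>X\<close>, separated sets in \<open>K\<close>. For compact \<open>X\<close>, \<open>n > 0\<close> and \<open>\<epsilon> > 0\<close>
  the minimum and the maximum exist (\<open>span_num_attained\<close>, \<open>sep_num_attained\<close>).
\<close>

definition span_num ::
  "'a::metric_space set \<Rightarrow> ('a \<Rightarrow> 'a) \<Rightarrow> nat \<Rightarrow> real \<Rightarrow> 'a set \<Rightarrow> nat" where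
  "span_num X f n \<epsilon> K = (LEAST k. \<exists>F\<subseteq>X. finite F \<and> card F = k \<and> spans f n \<epsilon> F K)"

definition sep_num :: "('a::metric_space \<Rightarrow> 'a) \<Rightarrow> nat \<Rightarrow> real \<Rightarrow> 'a set \<Rightarrow> nat" where
  "sep_num f n \<epsilon> K = (GREATEST k. \<exists>E\<subseteq>K. finite E \<and> card E = k \<and> separated f n \<epsilon> E)"

text \<open>
  The limit exists, possibly as \<open>\<infinity>\<close>, and agrees with the one formed with \<open>sep_num\<close>; see
  \<open>entropy_tendsto\<close> and \<open>entropy_tendsto_sep\<close>.
\<close>

definition entropy :: "'a::metric_space set \<Rightarrow> ('a \<Rightarrow> 'a) \<Rightarrow> 'a set \<Rightarrow> ereal" where
  "entropy X f K =
     Lim (at_right 0) (\<lambda>\<epsilon>. limsup (\<lambda>n. ereal (1 / real n * ln (real (span_num X f n \<epsilon> K)))))"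

definition entropy_pm :: "'a::metric_space set \<Rightarrow> ('a \<Rightarrow> 'a) \<Rightarrow> 'a set \<Rightarrow> ereal" where
  "entropy_pm X f K = max (entropy X f K) (entropy X (inv_into X f) K)"

definition tight :: "'a::metric_space set \<Rightarrow> ('a \<Rightarrow> 'a) \<Rightarrow> bool" where
  "tight X f \<longleftrightarrow> (\<forall>C\<subseteq>X. continuum C \<and> nondegenerate C \<longrightarrow> entropy_pm X f C > 0)"


lemma bowen_dist_le_iff:
  "n > 0 \<Longrightarrow> bowen_dist f n x y \<le> e \<longleftrightarrow> (\<forall>i<n. dist ((f ^^ i) x) ((f ^^ i) y) \<le> e)"
  unfolding bowen_dist_def by (subst Max_le_iff) auto

lemma bowen_dist_commute: "bowen_dist f n x y = bowen_dist f n y x"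
  unfolding bowen_dist_def by (simp add: dist_commute)

lemma bowen_dist_triangle_le:
  assumes "n > 0" "bowen_dist f n x z \<le> a" "bowen_dist f n y z \<le> b"
  shows "bowen_dist f n x y \<le> a + b"
proof -
  have "dist ((f ^^ i) x) ((f ^^ i) y) \<le> a + b" if "i < n" for i
  proof -
    have "dist ((f ^^ i) x) ((f ^^ i) z) \<le> a" "dist ((f ^^ i) y) ((f ^^ i) z) \<le> b"
      using assms that by (simp_all add: bowen_dist_le_iff)
    then show ?thesis using dist_triangle2[of "(f ^^ i) x" "(f ^^ i) y" "(f ^^ i) z"] by linarith
  qed
  then show ?thesis using assms(1) by (simp add: bowen_dist_le_iff)
qed

lemma funpow_continuous_on:
  assumes "continuous_on X f" "f ` X \<subseteq> X"
  shows "continuous_on X (f ^^ i) \<and> (f ^^ i) ` X \<subseteq> X"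
proof (induction i)
  case (Suc i)
  then have "continuous_on X (f \<circ> f ^^ i)"
    using assms by (intro continuous_on_compose) (auto intro: continuous_on_subset)
  then show ?case using Suc assms by auto
qed auto

lemma bowen_dist_uniform:
  assumes "compact X" "continuous_on X f" "f ` X \<subseteq> X" "e > 0"
  shows "\<exists>d>0. \<forall>x\<in>X. \<forall>y\<in>X. dist x y < d \<longrightarrow> (\<forall>i<n. dist ((f ^^ i) x) ((f ^^ i) y) < e)"
proof (induction n)
  case 0
  show ?case by (auto intro: exI[of _ 1])
next
  case (Suc n)
  then obtain d where d: "d > 0"
    "\<forall>x\<in>X. \<forall>y\<in>X. dist x y < d \<longrightarrow> (\<forall>i<n. dist ((f ^^ i) x) ((f ^^ i) y) < e)" by blast
  have "uniformly_continuous_on X (f ^^ n)"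
    using assms funpow_continuous_on[OF assms(2,3)] by (intro compact_uniformly_continuous) auto
  then obtain d' where d': "d' > 0"
    "\<forall>x\<in>X. \<forall>y\<in>X. dist x y < d' \<longrightarrow> dist ((f ^^ n) x) ((f ^^ n) y) < e"
    unfolding uniformly_continuous_on_def using assms(4) by (metis dist_commute)
  show ?case
    using d d' by (intro exI[of _ "min d d'"]) (auto simp: less_Suc_eq)
qed

lemma finite_spanning:
  assumes "compact X" "continuous_on X f" "f ` X \<subseteq> X" "K \<subseteq> X" "n > 0" "e > 0"
  shows "\<exists>F\<subseteq>X. finite F \<and> spans f n e F K"
proof -
  obtain d where d: "d > 0"
    "\<forall>x\<in>X. \<forall>y\<in>X. dist x y < d \<longrightarrow> (\<forall>i<n. dist ((f ^^ i) x) ((f ^^ i) y) < e)"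
    using bowen_dist_uniform[OF assms(1-3) assms(6)] by blast
  obtain F where F: "finite F" "F \<subseteq> X" "X \<subseteq> (\<Union>x\<in>F. ball x d)"
    using seq_compact_imp_totally_bounded[of X] assms(1) d(1)
    unfolding compact_eq_seq_compact_metric by blast
  have "spans f n e F K"
    unfolding spans_def
  proof
    fix x assume "x \<in> K"
    with F(3) assms(4) obtain y where y: "y \<in> F" "dist y x < d" by fastforce
    then have "bowen_dist f n x y \<le> e"
      using d(2) F(2) \<open>x \<in> K\<close> assms(4,5)
      by (subst bowen_dist_le_iff) (auto simp: dist_commute less_imp_le subset_iff)
    then show "\<exists>y\<in>F. bowen_dist f n x y \<le> e" using y by blast
  qed
  then show ?thesis using F by blast
qed

lemma span_num_le:
  "F \<subseteq> X \<Longrightarrow> finite F \<Longrightarrow> spans f n e F K \<Longrightarrow> span_num X f n e K \<le> card F"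
  unfolding span_num_def by (rule Least_le) blast

lemma span_num_attained:
  assumes "compact X" "continuous_on X f" "f ` X \<subseteq> X" "K \<subseteq> X" "n > 0" "e > 0"
  shows "\<exists>F\<subseteq>X. finite F \<and> card F = span_num X f n e K \<and> spans f n e F K"
proof -
  define P where "P k \<longleftrightarrow> (\<exists>F\<subseteq>X. finite F \<and> card F = k \<and> spans f n e F K)" for k
  have "Ex P" unfolding P_def using finite_spanning[OF assms] by blast
  then have "P (Least P)" by (rule LeastI_ex)
  moreover have "span_num X f n e K = Least P" unfolding span_num_def P_def ..
  ultimately show ?thesis by (simp add: P_def)
qed

lemma separated_card_le:
  assumes "separated f n e E" "E \<subseteq> K" "spans f n (e/2) F K" "finite F" "n > 0"
  shows "finite E \<and> card E \<le> card F"
proof -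
  have "\<forall>x\<in>E. \<exists>y\<in>F. bowen_dist f n x y \<le> e/2"
    using assms unfolding spans_def by blast
  then obtain p where p: "\<And>x. x \<in> E \<Longrightarrow> p x \<in> F \<and> bowen_dist f n x (p x) \<le> e/2" by metis
  have "inj_on p E"
  proof (rule inj_onI, rule ccontr)
    fix x y assume xy: "x \<in> E" "y \<in> E" "p x = p y" "x \<noteq> y"
    have "bowen_dist f n x y \<le> e/2 + e/2"
      by (rule bowen_dist_triangle_le[OF assms(5), of _ _ "p x"])
        (use p[OF xy(1)] p[OF xy(2)] xy(3) in auto)
    then show False using assms(1) xy unfolding separated_def by force
  qed
  moreover have "p ` E \<subseteq> F" using p by auto
  ultimately show ?thesis using assms(4) by (meson card_inj_on_le inj_on_finite)
qed

lemma
  assumes "compact X" "continuous_on X f" "f ` X \<subseteq> X" "K \<subseteq> X" "n > 0" "e > 0"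
  shows sep_num_attained: "\<exists>E\<subseteq>K. finite E \<and> card E = sep_num f n e K \<and> separated f n e E"
    and sep_num_ge: "\<And>E. E \<subseteq> K \<Longrightarrow> separated f n e E \<Longrightarrow> finite E \<and> card E \<le> sep_num f n e K"
    and sep_num_le_span_num: "sep_num f n e K \<le> span_num X f n (e/2) K"
    and span_num_le_sep_num: "span_num X f n e K \<le> sep_num f n e K"
proof -
  define P where "P k \<longleftrightarrow> (\<exists>E\<subseteq>K. finite E \<and> card E = k \<and> separated f n e E)" for k
  obtain F where F: "F \<subseteq> X" "finite F" "card F = span_num X f n (e/2) K" "spans f n (e/2) F K"
    using span_num_attained[OF assms(1-5), of "e/2"] assms(6) by auto
  have bound: "k \<le> card F" if "P k" for k
    using that separated_card_le F assms(5) unfolding P_def by blast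
  have "P 0" unfolding P_def separated_def by (auto intro: exI[of _ "{}"])
  then have PG: "P (Greatest P)" using bound by (intro GreatestI_nat[of P 0 "card F"])
  have G: "sep_num f n e K = Greatest P" unfolding sep_num_def P_def ..
  show att: "\<exists>E\<subseteq>K. finite E \<and> card E = sep_num f n e K \<and> separated f n e E"
    using PG unfolding G by (auto simp: P_def)
  show ge: "finite E \<and> card E \<le> sep_num f n e K" if "E \<subseteq> K" "separated f n e E" for E
  proof -
    have fin: "finite E" using separated_card_le that F assms(5) by blast
    then have "P (card E)" using that unfolding P_def by blast
    then show ?thesis using fin bound unfolding G by (auto intro: Greatest_le_nat)
  qed
  show "sep_num f n e K \<le> span_num X f n (e/2) K" using PG bound F G by metis
  obtain E where E: "E \<subseteq> K" "finite E" "card E = sep_num f n e K" "separated f n e E"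
    using att by blast
  have "spans f n e E K"
    unfolding spans_def
  proof (rule ballI, rule ccontr)
    fix x assume x: "x \<in> K" and "\<not> (\<exists>y\<in>E. bowen_dist f n x y \<le> e)"
    then have far: "\<And>y. y \<in> E \<Longrightarrow> bowen_dist f n x y > e" by force
    have "bowen_dist f n x x \<le> e" using assms by (simp add: bowen_dist_le_iff)
    then have "x \<notin> E" using far by force
    moreover have "separated f n e (insert x E)"
      using E(4) far bowen_dist_commute unfolding separated_def by (metis insert_iff)
    ultimately show False using ge[of "insert x E"] E x by auto
  qed
  then show "span_num X f n e K \<le> sep_num f n e K"
    using span_num_le[of E X] E assms(4) by auto
qed

lemma span_num_antimono:
  assumes "compact X" "continuous_on X f" "f ` X \<subseteq> X" "K \<subseteq> X" "n > 0" "e > 0" "e \<le> e'"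
  shows "span_num X f n e' K \<le> span_num X f n e K"
proof -
  obtain F where "F \<subseteq> X" "finite F" "card F = span_num X f n e K" "spans f n e F K"
    using span_num_attained[OF assms(1-6)] by blast
  then show ?thesis
    using span_num_le[of F X f n e' K] assms(7) unfolding spans_def by (metis order_trans)
qed

lemma ln_rate_mono:
  assumes "a \<le> b" shows "ereal (1 / real n * ln (real a)) \<le> ereal (1 / real n * ln (real b))"
proof (cases "a = 0")
  case True
  then show ?thesis by (cases "b = 0") auto
next
  case False
  then show ?thesis using assms by (auto intro!: divide_right_mono)
qed

lemma tendsto_at_right_0_antimono:
  fixes g :: "real \<Rightarrow> ereal"
  assumes "\<And>a b. 0 < a \<Longrightarrow> a \<le> b \<Longrightarrow> g b \<le> g a"
  shows "(g \<longlongrightarrow> (SUP e\<in>{0<..}. g e)) (at_right 0)"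
proof (rule order_tendstoI)
  fix y assume "y < (SUP e\<in>{0<..}. g e)"
  then obtain e where "e > 0" "y < g e" by (auto simp: less_SUP_iff)
  then show "\<forall>\<^sub>F x in at_right 0. y < g x"
    unfolding eventually_at_right_field using assms by (metis less_le_trans less_imp_le)
next
  fix y assume "(SUP e\<in>{0<..}. g e) < y"
  then have "g x < y" if "x > 0" for x
    using that SUP_upper[of x "{0<..}" g] by (auto intro: le_less_trans)
  then show "\<forall>\<^sub>F x in at_right 0. g x < y"
    unfolding eventually_at_right_field by (auto intro: exI[of _ 1])
qed

lemma
  fixes X :: "'a::metric_space set"
  assumes "compact X" "continuous_on X f" "f ` X \<subseteq> X" "K \<subseteq> X"
  shows entropy_tendsto:
      "((\<lambda>\<epsilon>. limsup (\<lambda>n. ereal (1 / real n * ln (real (span_num X f n \<epsilon> K))))) \<longlongrightarrow> entropy X f K)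
         (at_right 0)"
    and entropy_tendsto_sep:
      "((\<lambda>\<epsilon>. limsup (\<lambda>n. ereal (1 / real n * ln (real (sep_num f n \<epsilon> K))))) \<longlongrightarrow> entropy X f K)
         (at_right 0)"
    and entropy_eq_SUP:
      "entropy X f K =
         (SUP \<epsilon>\<in>{0<..}. limsup (\<lambda>n. ereal (1 / real n * ln (real (span_num X f n \<epsilon> K)))))"
proof -
  define R where "R \<epsilon> = limsup (\<lambda>n. ereal (1 / real n * ln (real (span_num X f n \<epsilon> K))))" for \<epsilon>
  define S where "S \<epsilon> = limsup (\<lambda>n. ereal (1 / real n * ln (real (sep_num f n \<epsilon> K))))" for \<epsilon>
  have "R b \<le> R a" if "0 < a" "a \<le> b" for a b
    unfolding R_def using that span_num_antimono[OF assms]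
    by (intro Limsup_mono eventually_mono[OF eventually_gt_at_top[of 0]] ln_rate_mono) auto
  then have lim: "(R \<longlongrightarrow> (SUP \<epsilon>\<in>{0<..}. R \<epsilon>)) (at_right 0)"
    by (rule tendsto_at_right_0_antimono)
  then have eq: "entropy X f K = (SUP \<epsilon>\<in>{0<..}. R \<epsilon>)"
    unfolding entropy_def R_def[symmetric] by (intro tendsto_Lim) auto
  then show "entropy X f K =
      (SUP \<epsilon>\<in>{0<..}. limsup (\<lambda>n. ereal (1 / real n * ln (real (span_num X f n \<epsilon> K)))))"
    by (simp add: R_def)
  have R: "(R \<longlongrightarrow> entropy X f K) (at_right 0)" using lim eq by simp
  then show "((\<lambda>\<epsilon>. limsup (\<lambda>n. ereal (1 / real n * ln (real (span_num X f n \<epsilon> K)))))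
      \<longlongrightarrow> entropy X f K) (at_right 0)" unfolding R_def .
  have "filterlim (\<lambda>\<epsilon>::real. \<epsilon>/2) (at_right 0) (at_right 0)"
    unfolding filterlim_at
    by (auto intro!: tendsto_eq_intros simp: eventually_at_right_field intro: exI[of _ 1])
  then have R2: "((\<lambda>\<epsilon>. R (\<epsilon>/2)) \<longlongrightarrow> entropy X f K) (at_right 0)"
    by (rule filterlim_compose[OF R])
  have "R e \<le> S e" if "e > 0" for e
    unfolding R_def S_def using that span_num_le_sep_num[OF assms]
    by (intro Limsup_mono eventually_mono[OF eventually_gt_at_top[of 0]] ln_rate_mono) auto
  moreover have "S e \<le> R (e/2)" if "e > 0" for e
    unfolding R_def S_def using that sep_num_le_span_num[OF assms]
    by (intro Limsup_mono eventually_mono[OF eventually_gt_at_top[of 0]] ln_rate_mono) auto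
  ultimately have "(S \<longlongrightarrow> entropy X f K) (at_right 0)"
    by (intro tendsto_sandwich[OF _ _ R R2])
      (auto simp: eventually_at_right_field intro: exI[of _ 1])
  then show "((\<lambda>\<epsilon>. limsup (\<lambda>n. ereal (1 / real n * ln (real (sep_num f n \<epsilon> K)))))
      \<longlongrightarrow> entropy X f K) (at_right 0)" unfolding S_def .
qed

end

theory Submission
  imports Defs
begin

text \<open>
  Let \<open>2 * c\<close> be an expansivity constant. By compactness there is \<open>N\<close> such that every continuum of
  diameter at least \<open>c / 3\<close> has diameter greater than \<open>c\<close> at some time \<open>k\<close> with \<open>\<bar>k\<bar> \<le> N\<close>. If such a
  continuum had diameter at most \<open>c\<close> during the last \<open>N\<close> steps, it must therefore grow within the
  next \<open>N\<close> steps. At the first time this happens, boundary bumping yields two subcontinua of the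
  iterate that have diameter at least \<open>c / 3\<close>, are more than \<open>c / 3\<close> apart, and have again been small
  during the last \<open>N\<close> steps; iterating, the number of separated points doubles every \<open>N\<close> steps, so
  the entropy is at least \<open>ln 2 / N\<close>. To start the process inside a given continuum, take a
  subcontinuum that stays small for all \<open>\<bar>k\<bar> \<le> N\<close> and wait until the first \<open>\<bar>k\<bar>\<close> at which it is
  expanded; the sign of that \<open>k\<close> decides between \<open>f\<close> and its inverse.
\<close>

section \<open>Subcontinua and limits of continua\<close>

text \<open>A pointwise bound in place of \<open>diameter\<close>: it passes to subsets and its
  negation directly yields two points that are far apart, with no boundedness or nonemptiness
  conditions on a supremum.\<close>

definition diam_le :: "real \<Rightarrow> 'a::metric_space set \<Rightarrow> bool" where
  "diam_le c A \<longleftrightarrow> (\<forall>x\<in>A. \<forall>y\<in>A. dist x y \<le> c)"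

lemma diam_le_subset: "diam_le c B \<Longrightarrow> A \<subseteq> B \<Longrightarrow> diam_le c A"
  unfolding diam_le_def by blast

lemma diam_le_mono: "diam_le a A \<Longrightarrow> a \<le> b \<Longrightarrow> diam_le b A"
  unfolding diam_le_def by force

lemma continuum_image: "continuum A \<Longrightarrow> continuous_on A f \<Longrightarrow> continuum (f ` A)"
  unfolding continuum_def by (auto intro: compact_continuous_image connected_continuous_image)

text \<open>Boundary bumping: the point \<open>q\<close> makes \<open>A \<inter> cball p r\<close> a
  proper closed subset of \<open>A\<close>, so its component at \<open>p\<close> meets its frontier
  relative to \<open>A\<close>. The open ball is interior to it, so such a frontier point lies on
  the sphere.\<close>

lemma subcontinuum_reaching_sphere:
  fixes A :: "'a::metric_space set"
  assumes A: "continuum A" and "p \<in> A" "q \<in> A" "0 < r" "r < dist p q"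
  obtains D z where "continuum D" "D \<subseteq> A" "D \<subseteq> cball p r" "p \<in> D" "z \<in> D" "dist p z = r"
proof -
  define Y where "Y = top_of_set A"
  define D where "D = connected_component_of_set (subtopology Y (A \<inter> cball p r)) p"
  have sub: "subtopology Y (A \<inter> cball p r) = top_of_set (A \<inter> cball p r)"
    unfolding Y_def by (simp add: subtopology_subtopology Int_absorb1)
  have pS: "p \<in> A \<inter> cball p r" using assms by auto
  have comp: "D \<in> connected_components_of (subtopology Y (A \<inter> cball p r))"
    unfolding D_def connected_components_of_def using pS sub by simp
  have "D \<inter> Y frontier_of (A \<inter> cball p r) \<noteq> {}"
  proof (rule boundary_bumping_theorem_closed)
    show "connected_space Y" "compact_space Y" "Hausdorff_space Y"
      unfolding Y_def using A by (auto simp: continuum_def connected_space_subtopology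
          compact_space_subtopology Hausdorff_space_subtopology)
    show "closedin Y (A \<inter> cball p r)" unfolding Y_def by (auto intro: closedin_closed_Int)
    show "A \<inter> cball p r \<noteq> topspace Y"
      using \<open>q \<in> A\<close> \<open>r < dist p q\<close> unfolding Y_def by force
  qed (rule comp)
  then obtain z where z: "z \<in> D" "z \<in> Y frontier_of (A \<inter> cball p r)" by blast
  have DS: "D \<subseteq> A \<inter> cball p r"
    using connected_components_of_subset[OF comp] sub by simp
  have "A \<inter> ball p r \<subseteq> Y interior_of (A \<inter> cball p r)"
    unfolding Y_def by (intro interior_of_maximal) (auto intro: openin_open_Int)
  then have "dist p z \<ge> r" using z DS unfolding frontier_of_def by force
  moreover have "connected D"
    using connectedin_connected_components_of[OF comp] unfolding sub
    by (simp add: connectedin_subtopology)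
  moreover have "compact D"
  proof -
    have "compact (A \<inter> cball p r)" using A by (auto simp: continuum_def compact_Int_closed)
    moreover have "closedin (top_of_set (A \<inter> cball p r)) D"
      using closedin_connected_components_of[OF comp] sub by simp
    ultimately show ?thesis by (rule closedin_compact)
  qed
  moreover have "p \<in> D"
    unfolding D_def using pS sub by (simp add: connected_component_of_refl)
  ultimately show thesis
    using that[of D z] z(1) DS unfolding continuum_def by force
qed

text \<open>The set is the topological upper limit of the sequence. Connectedness rests on the
  convergent choice \<open>p n\<close>: for large \<open>n\<close> it ties all of \<open>K n\<close>
  to the side of a separation that contains \<open>x\<close>, so nothing can accumulate on the other
  side.\<close>

lemma continuum_upper_limit:
  fixes K :: "nat \<Rightarrow> 'a::metric_space set"
  assumes X: "compact X" and K: "\<And>n. connected (K n)" "\<And>n. K n \<subseteq> X"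
    and p: "\<And>n. p n \<in> K n" "p \<longlonglongrightarrow> x"
  shows "continuum (\<Inter>m. closure (\<Union>n\<in>{m..}. K n))" (is "continuum ?L")
proof -
  define T where "T m = closure (\<Union>n\<in>{m..}. K n)" for m
  have L: "?L = (\<Inter>m. T m)" by (simp add: T_def)
  have closed: "closed (T m)" for m unfolding T_def by simp
  have KT: "K n \<subseteq> T m" if "m \<le> n" for m n
    unfolding T_def using that by (intro order_trans[OF _ closure_subset]) auto
  have anti: "T n \<subseteq> T m" if "m \<le> n" for m n
    unfolding T_def using that by (intro closure_mono UN_mono) auto
  have TX: "T m \<subseteq> X" for m
    unfolding T_def using K(2) X by (intro closure_minimal) (auto simp: compact_imp_closed)
  have xL: "x \<in> (\<Inter>m. T m)"
  proof
    fix m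
    have "eventually (\<lambda>n. p n \<in> T m) sequentially"
      using eventually_ge_at_top[of m] by eventually_elim (use KT p(1) in blast)
    then show "x \<in> T m" using closed p(2) by (intro Lim_in_closed_set[of "T m" p]) auto
  qed
  have clL: "closed (\<Inter>m. T m)" using closed by auto
  have "compact (\<Inter>m. T m)"
    using compact_Int_closed[OF X clL] TX by (metis INT_lower UNIV_I inf.absorb_iff2 order_trans)
  moreover have "connected (\<Inter>m. T m)"
    unfolding connected_closed_set[OF clL]
  proof clarify
    fix A B assume AB: "closed A" "closed B" "A \<noteq> {}" "B \<noteq> {}" "A \<union> B = (\<Inter>m. T m)" "A \<inter> B = {}"
    obtain U V where UV: "open U" "open V" "A \<subseteq> U" "B \<subseteq> V" "U \<inter> V = {}"
      using t4_space[OF AB(1,2,6)] by blast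
    \<comment> \<open>Otherwise points of \<open>T m\<close> outside \<open>U \<union> V\<close>
      accumulate, by compactness, at a point of every \<open>T m\<close> that is still outside
      \<open>U \<union> V\<close>.\<close>
    have "\<exists>m. T m \<subseteq> U \<union> V"
    proof (rule ccontr)
      assume "\<not> ?thesis"
      then have "\<forall>m. \<exists>w. w \<in> T m \<and> w \<in> X - (U \<union> V)" using TX by blast
      then obtain w where w: "\<And>m. w m \<in> T m" "\<And>m. w m \<in> X - (U \<union> V)" by metis
      have "compact (X - (U \<union> V))" using X UV by (intro compact_diff) auto
      then obtain l r where l: "l \<in> X - (U \<union> V)" "strict_mono r" "(w \<circ> r) \<longlonglongrightarrow> l"
        unfolding compact_def using w(2) by metis
      have "l \<in> T m" for m
      proof -
        have "eventually (\<lambda>n. (w \<circ> r) n \<in> T m) sequentially"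
          using eventually_ge_at_top[of m]
        proof eventually_elim
          case (elim n)
          then have "m \<le> r n" using seq_suble[OF l(2), of n] by simp
          then show ?case using w(1)[of "r n"] anti by auto
        qed
        then show ?thesis using closed l(3) by (intro Lim_in_closed_set[of "T m" "w \<circ> r"]) auto
      qed
      then show False using l(1) AB(5) UV by blast
    qed
    then obtain m where m: "T m \<subseteq> U \<union> V" ..
    \<comment> \<open>Stated for an arbitrary pair \<open>W\<close>, \<open>W'\<close> with
      \<open>x\<close> in \<open>W\<close>, so that \<open>U\<close> and \<open>V\<close> can take
      either role.\<close>
    have one: False
      if W: "open W" "open W'" "W \<inter> W' = {}" "x \<in> W" "T m \<subseteq> W \<union> W'" "b \<in> W'" "b \<in> (\<Inter>m. T m)" for W W' b
    proof -
      have "eventually (\<lambda>n. p n \<in> W) sequentially"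
        using p(2) W by (intro topological_tendstoD)
      then obtain n0 where n0: "\<And>n. n \<ge> n0 \<Longrightarrow> p n \<in> W"
        unfolding eventually_sequentially by blast
      have "K n \<inter> W' = {}" if n: "n \<ge> max m n0" for n
      proof (rule ccontr)
        assume "K n \<inter> W' \<noteq> {}"
        moreover have "K n \<subseteq> W \<union> W'" using KT[of m n] n W by auto
        moreover have "p n \<in> W \<inter> K n" using n0[of n] n p(1) by auto
        ultimately show False
          using connectedD[OF K(1)[of n] W(1,2)] W(3) by blast
      qed
      then have "(\<Union>n\<in>{max m n0..}. K n) \<subseteq> - W'" by blast
      then have "T (max m n0) \<subseteq> - W'"
        unfolding T_def using W(2) by (intro closure_minimal) (auto simp: closed_Compl)
      then show False using W by blast
    qed
    show False
    proof (cases "x \<in> U")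
      case True
      then show False using one[of U V] UV m AB by (metis UnCI all_not_in_conv subsetD)
    next
      case False
      then have "x \<in> V" using xL AB(5) UV by blast
      then show False using one[of V U] UV m AB by (metis UnCI Un_commute Int_commute all_not_in_conv subsetD)
    qed
  qed
  ultimately show ?thesis unfolding L continuum_def using xL by blast
qed

section \<open>Positive entropy from doubling separated sets\<close>

text \<open>Doubling the number of separated points every \<open>N\<close> steps gives growth rate
  at least \<open>ln 2 / N\<close> along the times \<open>r m\<close>, and the limsup over a
  subsequence bounds the full limsup from below.\<close>

lemma entropy_pos:
  fixes X :: "'a::metric_space set"
  assumes X: "compact X" "continuous_on X f" "f ` X \<subseteq> X" "C \<subseteq> X" and "e > 0" "N > 0"
    and E: "\<And>m. \<exists>E\<subseteq>C. card E = 2 ^ m \<and>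
      (\<forall>x\<in>E. \<forall>y\<in>E. x \<noteq> y \<longrightarrow> (\<exists>i\<le>a + m * N. dist ((f ^^ i) x) ((f ^^ i) y) > e))"
  shows "entropy X f C > 0"
proof -
  \<comment> \<open>Scale \<open>e/2\<close> because \<open>e\<close>-separated sets are bounded by
    \<open>e/2\<close>-spanning ones.\<close>
  define R where "R n = ereal (1 / real n * ln (real (span_num X f n (e/2) C)))" for n
  \<comment> \<open>\<open>Suc\<close> because the Bowen metric of length \<open>n\<close> sees only
    iterates below \<open>n\<close>, while separation may occur at time \<open>a + m * N\<close>
    itself.\<close>
  define r where "r m = Suc (a + m * N)" for m
  have r: "strict_mono r" unfolding r_def strict_mono_Suc_iff using \<open>N > 0\<close> by auto
  have "ereal (1 / real (r m) * (real m * ln 2)) \<le> (R \<circ> r) m" for m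
  proof -
    from E[of m] obtain E where "E \<subseteq> C \<and> card E = 2 ^ m \<and>
      (\<forall>x\<in>E. \<forall>y\<in>E. x \<noteq> y \<longrightarrow> (\<exists>i\<le>a + m * N. dist ((f ^^ i) x) ((f ^^ i) y) > e))" ..
    then have E: "E \<subseteq> C" "card E = 2 ^ m"
      "\<And>x y. x \<in> E \<Longrightarrow> y \<in> E \<Longrightarrow> x \<noteq> y \<Longrightarrow> \<exists>i\<le>a + m * N. dist ((f ^^ i) x) ((f ^^ i) y) > e"
      by simp_all
    have "separated f (r m) e E"
      unfolding separated_def
    proof (intro ballI impI)
      fix x y assume xy: "x \<in> E" "y \<in> E" "x \<noteq> y"
      have "\<not> bowen_dist f (r m) x y \<le> e"
        using E(3)[OF xy] by (subst bowen_dist_le_iff) (auto simp: r_def less_Suc_eq_le not_le)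
      then show "bowen_dist f (r m) x y > e" by simp
    qed
    then have "card E \<le> sep_num f (r m) e C"
      using sep_num_ge[OF X _ \<open>e > 0\<close> E(1)] by (simp add: r_def)
    also have "\<dots> \<le> span_num X f (r m) (e/2) C"
      using sep_num_le_span_num[OF X _ \<open>e > 0\<close>] by (simp add: r_def)
    finally have "2 ^ m \<le> span_num X f (r m) (e/2) C" using E(2) by simp
    from ln_rate_mono[OF this] show ?thesis by (simp add: R_def ln_realpow)
  qed
  then have "limsup (\<lambda>m. ereal (1 / real (r m) * (real m * ln 2))) \<le> limsup (R \<circ> r)"
    by (intro Limsup_mono) auto
  also have "\<dots> \<le> limsup R" by (rule limsup_subseq_mono[OF r])
  also have "\<dots> \<le> entropy X f C"
    unfolding entropy_eq_SUP[OF X] R_def using \<open>e > 0\<close> by (intro SUP_upper) auto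
  also have "limsup (\<lambda>m. ereal (1 / real (r m) * (real m * ln 2))) = ereal (ln 2 / real N)"
  proof (intro lim_imp_Limsup)
    have "(\<lambda>m. 1 / (real (Suc a) / real m + real N) * ln 2) \<longlonglongrightarrow> 1 / (0 + real N) * ln 2"
      using \<open>N > 0\<close> by (intro tendsto_intros lim_const_over_n) auto
    moreover have "\<forall>\<^sub>F m in sequentially. 1 / (real (Suc a) / real m + real N) * ln 2
        = 1 / real (r m) * (real m * ln 2)"
      using eventually_gt_at_top[of 0]
      by eventually_elim (simp add: r_def field_simps)
    ultimately show "(\<lambda>m. ereal (1 / real (r m) * (real m * ln 2))) \<longlonglongrightarrow> ereal (ln 2 / real N)"
      by (simp add: tendsto_cong)
  qed auto
  finally have "ereal (ln 2 / real N) \<le> entropy X f C" .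
  moreover have "0 < ereal (ln 2 / real N)" using \<open>N > 0\<close> by simp
  ultimately show ?thesis by (rule less_le_trans[rotated])
qed

section \<open>Integer actions and uniform expansivity\<close>

text \<open>Indexing by integers makes time reversal \<open>k \<mapsto> - k\<close> another
  instance, so every forward argument also serves the inverse. The laws hold on \<open>X\<close>
  only, since the iterates are uncontrolled elsewhere.\<close>

locale int_action =
  fixes X :: "'a::metric_space set" and h :: "int \<Rightarrow> 'a \<Rightarrow> 'a"
  assumes compact_space: "compact X"
    and continuous: "continuous_on X (h k)"
    and maps: "x \<in> X \<Longrightarrow> h k x \<in> X"
    and zero: "x \<in> X \<Longrightarrow> h 0 x = x"
    and add: "x \<in> X \<Longrightarrow> h j (h k x) = h (j + k) x"
begin

lemma image_add: "B \<subseteq> X \<Longrightarrow> h j ` h k ` B = h (j + k) ` B"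
  unfolding image_image by (intro image_cong) (auto simp: add)

lemma image_subset: "B \<subseteq> X \<Longrightarrow> h k ` B \<subseteq> X"
  using maps by blast

lemma continuum_iterate: "continuum B \<Longrightarrow> B \<subseteq> X \<Longrightarrow> continuum (h k ` B)"
  using continuum_image continuous continuous_on_subset by blast

lemma reverse: "int_action X (\<lambda>k. h (- k))"
  by unfold_locales (simp_all add: compact_space continuous maps zero add)

end

locale expansive_action = int_action +
  fixes c :: real
  assumes c_pos: "c > 0"
    and expansive: "continuum A \<Longrightarrow> A \<subseteq> X \<Longrightarrow> (\<And>k. diam_le (2 * c) (h k ` A)) \<Longrightarrow> \<exists>x. A = {x}"
begin

text \<open>If no \<open>N\<close> works, continua that stay small for longer and longer have an
  upper limit \<open>L\<close>. It contains the limits \<open>p\<close>, \<open>q\<close> of points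
  at distance at least \<open>\<delta>\<close>, yet none of its iterates exceeds
  \<open>2 * c\<close>, against expansivity.\<close>

lemma uniform_expansivity:
  assumes "\<delta> > 0"
  shows "\<exists>N>0. \<forall>A. continuum A \<and> A \<subseteq> X \<and> (\<exists>x\<in>A. \<exists>y\<in>A. dist x y \<ge> \<delta>) \<longrightarrow>
    (\<exists>k. \<bar>k\<bar> \<le> int N \<and> \<not> diam_le c (h k ` A))"
proof (rule ccontr)
  assume neg: "\<not> ?thesis"
  \<comment> \<open>The time bound is \<open>Suc n\<close> because \<open>neg\<close> refutes only
    positive bounds.\<close>
  have "\<exists>A x y. continuum A \<and> A \<subseteq> X \<and> x \<in> A \<and> y \<in> A \<and> dist x y \<ge> \<delta> \<and>
      (\<forall>k. \<bar>k\<bar> \<le> int (Suc n) \<longrightarrow> diam_le c (h k ` A))" for n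
  proof -
    have "\<not> (\<forall>A. continuum A \<and> A \<subseteq> X \<and> (\<exists>x\<in>A. \<exists>y\<in>A. dist x y \<ge> \<delta>) \<longrightarrow>
      (\<exists>k. \<bar>k\<bar> \<le> int (Suc n) \<and> \<not> diam_le c (h k ` A)))"
      using neg by blast
    then show ?thesis by blast
  qed
  then obtain A x y where A: "\<And>n. continuum (A n)" "\<And>n. A n \<subseteq> X" "\<And>n. x n \<in> A n" "\<And>n. y n \<in> A n"
    "\<And>n. dist (x n) (y n) \<ge> \<delta>"
    and small: "\<And>n k. \<bar>k\<bar> \<le> int (Suc n) \<Longrightarrow> diam_le c (h k ` A n)"
    by metis
  have "\<forall>n. x n \<in> X" "\<forall>n. y n \<in> X" using A(2-4) by blast+
  obtain p r where p: "p \<in> X" "strict_mono r" "(x \<circ> r) \<longlonglongrightarrow> p"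
    using compact_space \<open>\<forall>n. x n \<in> X\<close> unfolding compact_def by metis
  have "\<forall>n. (y \<circ> r) n \<in> X" using \<open>\<forall>n. y n \<in> X\<close> by simp
  then obtain q s where q: "q \<in> X" "strict_mono s" "((y \<circ> r) \<circ> s) \<longlonglongrightarrow> q"
    using compact_space unfolding compact_def by metis
  define t where "t = r \<circ> s"
  have t: "strict_mono t" unfolding t_def using p(2) q(2) by (rule strict_mono_o)
  have xt: "(\<lambda>n. x (t n)) \<longlonglongrightarrow> p"
    using LIMSEQ_subseq_LIMSEQ[OF p(3) q(2)] by (simp add: t_def comp_def)
  have yt: "(\<lambda>n. y (t n)) \<longlonglongrightarrow> q" using q(3) by (simp add: t_def comp_def)
  define K where "K n = A (t n)" for n
  define L where "L = (\<Inter>m. closure (\<Union>n\<in>{m..}. K n))"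
  have cL: "continuum L"
    unfolding L_def
    by (rule continuum_upper_limit[OF compact_space, of K "\<lambda>n. x (t n)" p])
      (use A xt in \<open>auto simp: K_def continuum_def\<close>)
  have LX: "L \<subseteq> X"
  proof -
    have "L \<subseteq> closure (\<Union>n\<in>{0..}. K n)" unfolding L_def by blast
    also have "\<dots> \<subseteq> X"
      using A(2) compact_space by (intro closure_minimal) (auto simp: K_def compact_imp_closed)
    finally show ?thesis .
  qed
  have inL: "z \<in> L" if "\<And>n. w n \<in> K n" "w \<longlonglongrightarrow> z" for w z
  proof -
    have "z \<in> closure (\<Union>n\<in>{m..}. K n)" for m
    proof (rule Lim_in_closed_set[OF closed_closure _ _ that(2)])
      show "\<forall>\<^sub>F n in sequentially. w n \<in> closure (\<Union>n\<in>{m..}. K n)"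
        using eventually_ge_at_top[of m]
      proof eventually_elim
        case (elim n)
        then have "w n \<in> (\<Union>n\<in>{m..}. K n)" using that(1) by auto
        then show ?case by (rule subsetD[OF closure_subset])
      qed
    qed simp
    then show ?thesis unfolding L_def by blast
  qed
  have pL: "p \<in> L" by (rule inL[OF _ xt]) (simp add: K_def A)
  have qL: "q \<in> L" by (rule inL[OF _ yt]) (simp add: K_def A)
  text \<open>Two points of \<open>L\<close> may be limits along different subsequences, so only their distances to
    the limit \<open>p\<close> of the full sequence are controlled; hence the constant \<open>2 * c\<close>.\<close>
  have near: "dist (h k p) (h k z) \<le> c" if z: "z \<in> L" for k z
  proof -
    \<comment> \<open>\<open>z\<close> is approached by points \<open>w m\<close> of
      \<open>K (i m)\<close> with \<open>i m \<ge> m\<close>. They share their continuum with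
      \<open>x (t (i m))\<close>, which tends to \<open>p\<close>, so once
      \<open>m \<ge> \<bar>k\<bar>\<close> the two are at most \<open>c\<close> apart at time
      \<open>k\<close>.\<close>
    have "\<exists>i w. i \<ge> m \<and> w \<in> K i \<and> dist w z < 1 / Suc m" for m
    proof -
      have "z \<in> closure (\<Union>n\<in>{m..}. K n)" using z unfolding L_def by blast
      then obtain w where "w \<in> (\<Union>n\<in>{m..}. K n)" "dist w z < 1 / Suc m"
        unfolding closure_approachable by (meson of_nat_0_less_iff zero_less_Suc zero_less_divide_1_iff)
      then show ?thesis by blast
    qed
    then obtain i w where iw: "\<And>m. i m \<ge> m" "\<And>m. w m \<in> K (i m)" "\<And>m. dist (w m) z < 1 / Suc m"
      by metis
    have wX: "w m \<in> X" for m using iw(2) A(2) by (auto simp: K_def)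
    have zX: "z \<in> X" using z LX by auto
    have "w \<longlonglongrightarrow> z"
    proof (rule tendstoI)
      fix e :: real assume "e > 0"
      then obtain m0 where "inverse (Suc m0) < e" using reals_Archimedean by blast
      then have "1 / Suc m < e" if "m \<ge> m0" for m
        using that by (intro le_less_trans[of "1 / Suc m" "inverse (Suc m0)" e]) (auto simp: field_simps)
      then show "\<forall>\<^sub>F m in sequentially. dist (w m) z < e"
        unfolding eventually_sequentially using iw(3) less_trans by blast
    qed
    then have hw: "(\<lambda>m. h k (w m)) \<longlonglongrightarrow> h k z"
      using continuous_on_tendsto_compose[OF continuous, of w z] wX zX by simp
    have "filterlim i at_top sequentially"
      using iw(1) by (intro filterlim_at_top_mono[OF filterlim_ident]) auto
    then have "(\<lambda>m. x (t (i m))) \<longlonglongrightarrow> p" by (rule filterlim_compose[OF xt])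
    then have hx: "(\<lambda>m. h k (x (t (i m)))) \<longlonglongrightarrow> h k p"
      using continuous_on_tendsto_compose[OF continuous, of "\<lambda>m. x (t (i m))" p] \<open>\<forall>n. x n \<in> X\<close> p(1)
      by simp
    have "\<forall>\<^sub>F m in sequentially. dist (h k (x (t (i m)))) (h k (w m)) \<le> c"
      using eventually_ge_at_top[of "nat \<bar>k\<bar>"]
    proof eventually_elim
      case (elim m)
      have "nat \<bar>k\<bar> \<le> t (i m)" using elim iw(1)[of m] seq_suble[OF t, of "i m"] by linarith
      then have "diam_le c (h k ` A (t (i m)))" by (intro small) linarith
      then show ?case unfolding diam_le_def using A(3) iw(2)[of m] by (auto simp: K_def)
    qed
    then show ?thesis
      by (intro tendsto_upperbound[OF tendsto_dist[OF hx hw]]) auto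
  qed
  have "diam_le (2 * c) (h k ` L)" for k
    unfolding diam_le_def
  proof clarify
    fix u v assume "u \<in> L" "v \<in> L"
    then show "dist (h k u) (h k v) \<le> 2 * c"
      using near[of u k] near[of v k] dist_triangle3[of "h k u" "h k v" "h k p"] by linarith
  qed
  then obtain z where "L = {z}" using expansive[OF cL LX] by blast
  then have "p = q" using pL qL by simp
  moreover have "dist p q \<ge> \<delta>"
    by (rule tendsto_lowerbound[OF tendsto_dist[OF xt yt]]) (use A(5) in auto)
  ultimately show False using assms by simp
qed

end

section \<open>Splitting unstable pieces\<close>

text \<open>The window of times is \<open>0\<close> to \<open>a\<close> inclusive, so that windows
  simply add when sets are pulled back.\<close>

definition separated_within :: "(int \<Rightarrow> 'a::metric_space \<Rightarrow> 'a) \<Rightarrow> real \<Rightarrow> nat \<Rightarrow> 'a set \<Rightarrow> bool" where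
  "separated_within h e a E \<longleftrightarrow>
    (\<forall>x\<in>E. \<forall>y\<in>E. x \<noteq> y \<longrightarrow> (\<exists>i\<le>a. dist (h (int i) x) (h (int i) y) > e))"

text \<open>Size \<open>c / 3\<close> forces an expansion within \<open>N\<close> steps in one time
  direction; the small past, which includes the present \<open>i = 0\<close>, leaves only the
  future.\<close>

definition unstable_piece ::
  "'a::metric_space set \<Rightarrow> (int \<Rightarrow> 'a \<Rightarrow> 'a) \<Rightarrow> real \<Rightarrow> nat \<Rightarrow> 'a set \<Rightarrow> bool" where
  "unstable_piece X h c N B \<longleftrightarrow> continuum B \<and> B \<subseteq> X \<and> (\<exists>x\<in>B. \<exists>y\<in>B. dist x y \<ge> c / 3) \<and>
    (\<forall>i. 0 \<le> i \<and> i \<le> int N \<longrightarrow> diam_le c (h (- i) ` B))"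

text \<open>The witness is \<open>h (- int k)\<close> applied to \<open>E\<close>: its points return
  to \<open>E\<close> after \<open>k\<close> steps, which shows injectivity and delays every
  separation by \<open>k\<close>.\<close>

lemma (in int_action) separated_within_pull_back:
  assumes "B \<subseteq> X" and E: "E \<subseteq> h (int k) ` B" "separated_within h e a E"
  shows "\<exists>E'\<subseteq>B. card E' = card E \<and> separated_within h e (k + a) E'"
proof (intro exI conjI)
  have EX: "E \<subseteq> X" using E(1) image_subset[OF assms(1)] by blast
  have "h (- int k) ` E \<subseteq> h (- int k) ` h (int k) ` B" using E(1) by (rule image_mono)
  also have "\<dots> = B" using assms(1) zero by (force simp: image_add)
  finally show "h (- int k) ` E \<subseteq> B" .
  have cancel: "h (int k) (h (- int k) u) = u" if "u \<in> E" for u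
    using that EX add[of u "int k" "- int k"] zero by auto
  then have "inj_on (h (- int k)) E" by (rule inj_on_inverseI)
  then show "card (h (- int k) ` E) = card E" by (rule card_image)
  show "separated_within h e (k + a) (h (- int k) ` E)"
    unfolding separated_within_def
  proof clarify
    fix u v assume uv: "u \<in> E" "v \<in> E" "h (- int k) u \<noteq> h (- int k) v"
    then obtain i where i: "i \<le> a" "dist (h (int i) u) (h (int i) v) > e"
      using E(2) unfolding separated_within_def by metis
    have "h (int (k + i)) (h (- int k) w) = h (int i) w" if "w \<in> E" for w
      using that EX add by auto
    then show "\<exists>i\<le>k + a. e < dist (h (int i) (h (- int k) u)) (h (int i) (h (- int k) v))"
      using i uv by (intro exI[of _ "k + i"]) simp
  qed
qed

context expansive_action
begin

text \<open>Expansivity quantifies over all integer times, so reversal preserves it with the same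
  constant.\<close>

lemma reverse_expansive: "expansive_action X (\<lambda>k. h (- k)) c"
proof -
  interpret rev: int_action X "\<lambda>k. h (- k)" by (rule reverse)
  show ?thesis
  proof
    show "\<exists>x. A = {x}" if "continuum A" "A \<subseteq> X" "\<And>k. diam_le (2 * c) (h (- k) ` A)" for A
      using that(3)[of "- k" for k] by (intro expansive that(1,2)) simp
  qed (rule c_pos)
qed

text \<open>The set \<open>A\<close> may itself be larger than \<open>c\<close>, as
  \<open>past\<close> starts at \<open>i = 1\<close>. A subcontinuum within \<open>c / 3\<close> of
  \<open>p\<close> has diameter at most \<open>2 * c / 3\<close>, which restores the bound at
  \<open>i = 0\<close>, and reaching the sphere keeps its size at least
  \<open>c / 3\<close>.\<close>

lemma unstable_piece_near:
  assumes A: "continuum A" "A \<subseteq> X" "p \<in> A" "q \<in> A" "dist p q > c / 3"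
    and past: "\<And>i. 0 < i \<Longrightarrow> i \<le> int N \<Longrightarrow> diam_le c (h (- i) ` A)"
  shows "\<exists>D\<subseteq>A. D \<subseteq> cball p (c / 3) \<and> unstable_piece X h c N D"
proof -
  obtain D z where D: "continuum D" "D \<subseteq> A" "D \<subseteq> cball p (c / 3)" "p \<in> D" "z \<in> D" "dist p z = c / 3"
    using subcontinuum_reaching_sphere[OF A(1,3,4) _ A(5)] c_pos by auto
  have "diam_le c (h (- i) ` D)" if "0 \<le> i" "i \<le> int N" for i
  proof (cases "i = 0")
    case True
    have "dist x y \<le> c" if "x \<in> D" "y \<in> D" for x y
    proof -
      have "dist p x \<le> c / 3" "dist p y \<le> c / 3" using that D(3) by auto
      then show ?thesis using dist_triangle3[of x y p] c_pos by linarith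
    qed
    moreover have "h 0 x = x" if "x \<in> D" for x using that zero D(2) A(2) by auto
    ultimately show ?thesis using True unfolding diam_le_def by simp
  next
    case False
    then show ?thesis using that past[of i] D(2) diam_le_subset by (metis image_mono le_less)
  qed
  moreover have "D \<subseteq> X" using D(2) A(2) by (rule subset_trans)
  ultimately have "unstable_piece X h c N D"
    unfolding unstable_piece_def using D by (metis order_refl)
  then show ?thesis using D by blast
qed

text \<open>The conclusion of \<open>uniform_expansivity\<close> for
  \<open>\<delta> = c / 3\<close>, kept as a hypothesis so that one \<open>N\<close> can be used for
  the action and for its reversal.\<close>

context
  fixes N :: nat
  assumes unif: "\<And>A x y. continuum A \<Longrightarrow> A \<subseteq> X \<Longrightarrow> x \<in> A \<Longrightarrow> y \<in> A \<Longrightarrow> c / 3 \<le> dist x y \<Longrightarrow>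
    \<exists>k. \<bar>k\<bar> \<le> int N \<and> \<not> diam_le c (h k ` A)"
begin

text \<open>At the first time \<open>k\<close> of expansion the image has two points more than
  \<open>c\<close> apart. Pieces within \<open>c / 3\<close> of each are still more than
  \<open>c / 3\<close> apart.\<close>

lemma unstable_piece_splits:
  assumes B: "unstable_piece X h c N B"
  shows "\<exists>k\<le>N. \<exists>D1 D2. D1 \<subseteq> h (int k) ` B \<and> D2 \<subseteq> h (int k) ` B \<and>
    unstable_piece X h c N D1 \<and> unstable_piece X h c N D2 \<and> (\<forall>u\<in>D1. \<forall>v\<in>D2. dist u v > c / 3)"
proof -
  from B obtain x y where B': "continuum B" "B \<subseteq> X" "x \<in> B" "y \<in> B" "dist x y \<ge> c / 3"
    and past: "\<And>i. 0 \<le> i \<Longrightarrow> i \<le> int N \<Longrightarrow> diam_le c (h (- i) ` B)"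
    unfolding unstable_piece_def by blast
  obtain j where j: "\<bar>j\<bar> \<le> int N" "\<not> diam_le c (h j ` B)" using unif[OF B'] by blast
  have "0 \<le> j" using past[of "- j"] j by (cases "0 \<le> j") auto
  define P where "P m \<longleftrightarrow> \<not> diam_le c (h (int m) ` B)" for m
  define k where "k = (LEAST m. P m)"
  have Pj: "P (nat j)" unfolding P_def using \<open>0 \<le> j\<close> j(2) by simp
  then have Pk: "P k" unfolding k_def by (rule LeastI)
  have "k \<le> nat j" unfolding k_def using Pj by (rule Least_le)
  then have kN: "k \<le> N" using j(1) by linarith
  have below: "diam_le c (h (int m) ` B)" if "m < k" for m
    using not_less_Least[of m P] that unfolding k_def P_def by blast
  define A where "A = h (int k) ` B"
  have A: "continuum A" "A \<subseteq> X" unfolding A_def using B' continuum_iterate image_subset by blast+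
  obtain p q where pq: "p \<in> A" "q \<in> A" "dist p q > c"
    using Pk unfolding P_def A_def diam_le_def by (meson not_le)
  have pastA: "diam_le c (h (- i) ` A)" if "0 < i" "i \<le> int N" for i
  proof -
    \<comment> \<open>Going back from \<open>A\<close> leads to time \<open>int k - i\<close> of
      \<open>B\<close>: minimality of \<open>k\<close> covers the nonnegative times, and the past of
      \<open>B\<close> the negative ones.\<close>
    have eq: "h (- i) ` A = h (int k - i) ` B" unfolding A_def using image_add[OF B'(2)] by simp
    show ?thesis
    proof (cases "i \<le> int k")
      case True
      then show ?thesis unfolding eq using below[of "nat (int k - i)"] that by simp
    next
      case False
      then show ?thesis unfolding eq using past[of "i - int k"] that by simp
    qed
  qed
  have far: "dist p q > c / 3" "dist q p > c / 3" using pq(3) c_pos by (auto simp: dist_commute)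
  obtain D1 where D1: "D1 \<subseteq> A" "D1 \<subseteq> cball p (c / 3)" "unstable_piece X h c N D1"
    using unstable_piece_near[OF A pq(1,2) far(1) pastA] by blast
  obtain D2 where D2: "D2 \<subseteq> A" "D2 \<subseteq> cball q (c / 3)" "unstable_piece X h c N D2"
    using unstable_piece_near[OF A pq(2,1) far(2) pastA] by blast
  have "dist u v > c / 3" if "u \<in> D1" "v \<in> D2" for u v
  proof -
    have "dist p u \<le> c / 3" "dist q v \<le> c / 3" using that D1(2) D2(2) by auto
    then show ?thesis
      using pq(3) dist_triangle[of p q u] dist_triangle2[of u q v] by linarith
  qed
  then show ?thesis using kN D1 D2 unfolding A_def by blast
qed

text \<open>Induction by splitting: each half contributes \<open>2 ^ m\<close> points, and points of
  different halves are already separated at time \<open>0\<close>. Pulling back to \<open>B\<close>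
  costs \<open>k \<le> N\<close> further steps.\<close>

lemma unstable_piece_separated:
  "unstable_piece X h c N B \<Longrightarrow>
    \<exists>E\<subseteq>B. card E = 2 ^ m \<and> separated_within h (c / 3) (m * N) E"
proof (induction m arbitrary: B)
  case 0
  then obtain x where "x \<in> B" unfolding unstable_piece_def by blast
  then show ?case by (intro exI[of _ "{x}"]) (simp add: separated_within_def)
next
  case (Suc m)
  obtain k D1 D2 where k: "k \<le> N" and D: "D1 \<subseteq> h (int k) ` B" "D2 \<subseteq> h (int k) ` B"
    "unstable_piece X h c N D1" "unstable_piece X h c N D2"
    and far: "\<And>u v. u \<in> D1 \<Longrightarrow> v \<in> D2 \<Longrightarrow> dist u v > c / 3"
    using unstable_piece_splits[OF Suc.prems] by blast
  obtain E1 where E1: "E1 \<subseteq> D1" "card E1 = 2 ^ m" "separated_within h (c / 3) (m * N) E1"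
    using Suc.IH[OF D(3)] by blast
  obtain E2 where E2: "E2 \<subseteq> D2" "card E2 = 2 ^ m" "separated_within h (c / 3) (m * N) E2"
    using Suc.IH[OF D(4)] by blast
  have BX: "B \<subseteq> X" using Suc.prems unfolding unstable_piece_def by blast
  have far': "\<exists>i\<le>m * N. dist (h (int i) u) (h (int i) v) > c / 3"
    if "u \<in> E1 \<and> v \<in> E2 \<or> v \<in> E1 \<and> u \<in> E2" for u v
  proof -
    have "u \<in> X" "v \<in> X" using that E1(1) E2(1) D(1,2) image_subset[OF BX] by blast+
    moreover have "dist u v > c / 3"
      using that far[of u v] far[of v u] E1(1) E2(1) by (auto simp: dist_commute)
    ultimately show ?thesis by (intro exI[of _ 0]) (simp add: zero)
  qed
  have "E1 \<inter> E2 = {}" using far E1(1) E2(1) c_pos by force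
  moreover have "finite E1" "finite E2" using E1(2) E2(2) by (auto intro: card_ge_0_finite)
  ultimately have "card (E1 \<union> E2) = 2 ^ Suc m" using E1(2) E2(2) by (simp add: card_Un_disjoint)
  moreover have "separated_within h (c / 3) (m * N) (E1 \<union> E2)"
    unfolding separated_within_def
  proof (intro ballI impI)
    fix u v assume uv: "u \<in> E1 \<union> E2" "v \<in> E1 \<union> E2" "u \<noteq> v"
    then consider "u \<in> E1" "v \<in> E1" | "u \<in> E2" "v \<in> E2" | "u \<in> E1 \<and> v \<in> E2 \<or> v \<in> E1 \<and> u \<in> E2"
      by blast
    then show "\<exists>i\<le>m * N. dist (h (int i) u) (h (int i) v) > c / 3"
      using E1(3) E2(3) uv(3) far' unfolding separated_within_def by cases blast+
  qed
  moreover have "E1 \<union> E2 \<subseteq> h (int k) ` B" using E1(1) E2(1) D(1,2) by blast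
  ultimately obtain E where E: "E \<subseteq> B" "card E = 2 ^ Suc m" "separated_within h (c / 3) (k + m * N) E"
    using separated_within_pull_back[OF BX] by metis
  have "k + m * N \<le> Suc m * N" using k by simp
  then have "separated_within h (c / 3) (Suc m * N) E"
    using E(3) unfolding separated_within_def by (meson order_trans)
  then show ?case using E by blast
qed

lemma unstable_piece_preimage_separated:
  assumes "C \<subseteq> X" "B \<subseteq> h (int n) ` C" "unstable_piece X h c N B"
  shows "\<exists>E\<subseteq>C. card E = 2 ^ m \<and> separated_within h (c / 3) (n + m * N) E"
proof -
  obtain E where "E \<subseteq> B" "card E = 2 ^ m" "separated_within h (c / 3) (m * N) E"
    using unstable_piece_separated[OF assms(3)] by blast
  then show ?thesis
    using separated_within_pull_back[OF assms(1), of E n] assms(2) by (metis subset_trans)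
qed

end

section \<open>Starting the process inside a given continuum\<close>

text \<open>As \<open>N < n\<close>, the \<open>N\<close> steps before time \<open>n\<close> lie
  strictly between \<open>0\<close> and \<open>n\<close>, where \<open>A\<close> is still small.
  This is the past that \<open>unstable_piece_near\<close> requires.\<close>

lemma unstable_piece_at_first_expansion:
  assumes A: "continuum A" "A \<subseteq> X" and "N < n" "\<not> diam_le c (h (int n) ` A)"
    and small: "\<And>i. \<bar>i\<bar> < int n \<Longrightarrow> diam_le c (h i ` A)"
  shows "\<exists>B\<subseteq>h (int n) ` A. unstable_piece X h c N B"
proof -
  obtain p q where pq: "p \<in> h (int n) ` A" "q \<in> h (int n) ` A" "dist p q > c"
    using assms(4) unfolding diam_le_def by (meson not_le)
  have "diam_le c (h (- i) ` h (int n) ` A)" if "0 < i" "i \<le> int N" for i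
    using that \<open>N < n\<close> small[of "int n - i"] by (simp add: image_add[OF A(2)])
  moreover have "c / 3 < dist p q" using pq(3) c_pos by simp
  ultimately show ?thesis
    using unstable_piece_near[OF continuum_iterate[OF A] image_subset[OF A(2)] pq(1,2)] by blast
qed

lemma unstable_piece_exists:
  assumes C: "continuum C" "C \<subseteq> X" "nondegenerate C"
  shows "\<exists>n. (\<exists>B\<subseteq>h (int n) ` C. unstable_piece X h c N B) \<or>
    (\<exists>B\<subseteq>h (- int n) ` C. unstable_piece X (\<lambda>k. h (- k)) c N B)"
proof -
  obtain x y where xy: "x \<in> C" "y \<in> C" "x \<noteq> y" using C(3) unfolding nondegenerate_def by blast
  have xX: "x \<in> X" using xy C(2) by blast
  have "\<forall>\<^sub>F z in at x within X. \<forall>k\<in>{- int N..int N}. dist (h k z) (h k x) < c / 2"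
    using continuous c_pos xX by (intro eventually_ball_finite ballI tendstoD) (auto simp: continuous_on_def)
  \<comment> \<open>One radius serves the finitely many times. The filter excludes \<open>x\<close>
    itself, hence the case split in \<open>near\<close>.\<close>
  then obtain d where d: "d > 0" "\<And>z k. z \<in> X \<Longrightarrow> z \<noteq> x \<Longrightarrow> dist z x < d \<Longrightarrow>
      k \<in> {- int N..int N} \<Longrightarrow> dist (h k z) (h k x) < c / 2"
    unfolding eventually_at by blast
  \<comment> \<open>Below \<open>d\<close>, so that \<open>A\<close> stays small up to time
    \<open>N\<close> in both directions; below \<open>dist x y\<close>, so that boundary bumping
    applies.\<close>
  define r where "r = min d (dist x y) / 2"
  have r: "0 < r" "r < dist x y" "r < d" unfolding r_def using d(1) xy(3) by (auto simp: min_def)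
  obtain A z where A: "continuum A" "A \<subseteq> C" "A \<subseteq> cball x r" "x \<in> A" "z \<in> A" "dist x z = r"
    using subcontinuum_reaching_sphere[OF C(1) xy(1,2) r(1,2)] by blast
  have AX: "A \<subseteq> X" using A(2) C(2) by (rule subset_trans)
  have near: "dist (h k x) (h k u) \<le> c / 2" if "\<bar>k\<bar> \<le> int N" "u \<in> A" for k u
  proof (cases "u = x")
    case False
    have "dist u x < d" using A(3) that(2) r(3) by (auto simp: dist_commute)
    then show ?thesis using d(2)[of u k] that AX False by (force simp: dist_commute)
  qed (use c_pos in simp)
  have small: "diam_le c (h k ` A)" if k: "\<bar>k\<bar> \<le> int N" for k
    unfolding diam_le_def
  proof clarify
    fix u v assume "u \<in> A" "v \<in> A"
    then show "dist (h k u) (h k v) \<le> c"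
      using near[OF k, of u] near[OF k, of v] dist_triangle3[of "h k u" "h k v" "h k x"] by linarith
  qed
  \<comment> \<open>Minimising \<open>\<bar>k\<bar>\<close>, not a one-sided time, makes
    \<open>A\<close> small at all times of smaller absolute value, whichever sign the first
    expansion has.\<close>
  define P where "P n \<longleftrightarrow> (\<exists>k. \<bar>k\<bar> = int n \<and> \<not> diam_le c (h k ` A))" for n
  define n where "n = (LEAST n. P n)"
  have "\<exists>k. \<not> diam_le c (h k ` A)"
  proof (rule ccontr)
    assume "\<not> ?thesis"
    then have "diam_le (2 * c) (h k ` A)" for k
      by (intro diam_le_mono[of c _ "2 * c"]) (use c_pos in auto)
    then obtain w where "A = {w}" using expansive[OF A(1) AX] by blast
    then show False using A(4-6) r(1) by simp
  qed
  then obtain k where "\<not> diam_le c (h k ` A)" by blast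
  then have "P (nat \<bar>k\<bar>)" unfolding P_def by auto
  then have "P n" unfolding n_def by (rule LeastI)
  then obtain j where j: "\<bar>j\<bar> = int n" "\<not> diam_le c (h j ` A)" unfolding P_def by blast
  have below: "diam_le c (h i ` A)" if "\<bar>i\<bar> < int n" for i
    using not_less_Least[of "nat \<bar>i\<bar>" P] that unfolding n_def[symmetric] by (auto simp: P_def)
  have "N < n" using small[of j] j by linarith
  interpret rev: expansive_action X "\<lambda>k. h (- k)" c by (rule reverse_expansive)
  consider "j = int n" | "j = - int n" using j(1) by linarith
  then show ?thesis
  proof cases
    case 1
    then show ?thesis
      using unstable_piece_at_first_expansion[OF A(1) AX \<open>N < n\<close>] j(2) below A(2)
      by (meson image_mono subset_trans)
  next
    case 2
    have "\<exists>B\<subseteq>h (- int n) ` A. unstable_piece X (\<lambda>k. h (- k)) c N B"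
      by (rule rev.unstable_piece_at_first_expansion[OF A(1) AX \<open>N < n\<close>]) (use j(2) 2 below in auto)
    then show ?thesis using A(2) by (meson image_mono subset_trans)
  qed
qed

lemma exponentially_many_separated:
  assumes C: "continuum C" "C \<subseteq> X" "nondegenerate C"
  shows "\<exists>N>0. \<exists>a.
    (\<forall>m. \<exists>E\<subseteq>C. card E = 2 ^ m \<and> separated_within h (c / 3) (a + m * N) E) \<or>
    (\<forall>m. \<exists>E\<subseteq>C. card E = 2 ^ m \<and> separated_within (\<lambda>k. h (- k)) (c / 3) (a + m * N) E)"
proof -
  interpret rev: expansive_action X "\<lambda>k. h (- k)" c by (rule reverse_expansive)
  obtain N where "N > 0" and N: "\<forall>A. continuum A \<and> A \<subseteq> X \<and> (\<exists>x\<in>A. \<exists>y\<in>A. dist x y \<ge> c / 3) \<longrightarrow>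
      (\<exists>k. \<bar>k\<bar> \<le> int N \<and> \<not> diam_le c (h k ` A))"
    using uniform_expansivity[of "c / 3"] c_pos by auto
  have unif: "\<exists>k. \<bar>k\<bar> \<le> int N \<and> \<not> diam_le c (h k ` A)"
    if "continuum A" "A \<subseteq> X" "x \<in> A" "y \<in> A" "c / 3 \<le> dist x y" for A x y
    using N that by blast
  \<comment> \<open>The window \<open>\<bar>k\<bar> \<le> int N\<close> is symmetric, so the same
    \<open>N\<close> works for the reversed action.\<close>
  have unif': "\<exists>k. \<bar>k\<bar> \<le> int N \<and> \<not> diam_le c (h (- k) ` A)"
    if "continuum A" "A \<subseteq> X" "x \<in> A" "y \<in> A" "c / 3 \<le> dist x y" for A x y
    using unif[OF that] by (metis abs_minus_cancel minus_minus)
  obtain n where "(\<exists>B\<subseteq>h (int n) ` C. unstable_piece X h c N B) \<or>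
    (\<exists>B\<subseteq>h (- int n) ` C. unstable_piece X (\<lambda>k. h (- k)) c N B)"
    using unstable_piece_exists[OF C] by blast
  then show ?thesis
  proof (elim disjE exE conjE)
    fix B assume B: "B \<subseteq> h (int n) ` C" "unstable_piece X h c N B"
    have "\<exists>E\<subseteq>C. card E = 2 ^ m \<and> separated_within h (c / 3) (n + m * N) E" for m
      by (rule unstable_piece_preimage_separated[OF _ C(2) B]) (rule unif)
    then show ?thesis using \<open>N > 0\<close> by blast
  next
    fix B assume B: "B \<subseteq> h (- int n) ` C" "unstable_piece X (\<lambda>k. h (- k)) c N B"
    have "\<exists>E\<subseteq>C. card E = 2 ^ m \<and> separated_within (\<lambda>k. h (- k)) (c / 3) (n + m * N) E" for m
      by (rule rev.unstable_piece_preimage_separated[OF _ C(2) B]) (rule unif')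
    then show ?thesis using \<open>N > 0\<close> by blast
  qed
qed

end

section \<open>Integer iterates of a homeomorphism, and tightness\<close>

lemma homeomorphism_int_action:
  assumes X: "compact X" and hom: "homeomorphism X X f g"
  shows "int_action X (int_iterate X f)"
proof -
  define h where "h = int_iterate X f"
  define f' where "f' = inv_into X f"
  have bij: "bij_betw f X X"
    using hom unfolding bij_betw_def homeomorphism_def by (metis inj_on_inverseI)
  have f: "f x \<in> X" if "x \<in> X" for x using bij that by (rule bij_betwE[rule_format])
  have f': "f' x \<in> X" "f (f' x) = x" "f' (f x) = x" if "x \<in> X" for x
    using bij that unfolding f'_def bij_betw_def
    by (auto simp: inv_into_f_f intro: inv_into_into f_inv_into_f)
  \<comment> \<open>\<open>inv_into X f\<close> and \<open>g\<close> are compared on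
    \<open>X\<close> only, which is enough to transfer continuity on \<open>X\<close>.\<close>
  have "f' x = g x" if "x \<in> X" for x
    using hom f' that unfolding homeomorphism_def by metis
  then have cont': "continuous_on X f'"
    using hom continuous_on_cong unfolding homeomorphism_def by metis
  have hX: "h k x \<in> X \<and> continuous_on X (h k)" if "x \<in> X" for k x
  proof -
    have "continuous_on X (f ^^ n) \<and> (f ^^ n) ` X \<subseteq> X" "continuous_on X (f' ^^ n) \<and> (f' ^^ n) ` X \<subseteq> X" for n
      using funpow_continuous_on[of X f n] funpow_continuous_on[of X f' n] hom cont' f f'(1)
      unfolding homeomorphism_def by blast+
    then show ?thesis using that unfolding h_def int_iterate_def f'_def[symmetric] by (auto simp: image_subset_iff)
  qed
  have h0: "h 0 x = x" for x unfolding h_def int_iterate_def by simp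
  \<comment> \<open>This rule and its converse \<open>pre\<close> cross the case distinction at
    \<open>0\<close> once, so that the group law follows by induction on \<open>j\<close> in both
    directions.\<close>
  have suc: "h (k + 1) x = f (h k x)" if x: "x \<in> X" for k x
  proof (cases "k \<ge> 0")
    case True
    then show ?thesis unfolding h_def int_iterate_def by (simp add: nat_add_distrib)
  next
    case False
    then obtain n where n: "k = - int (Suc n)" using negD by (metis not_le)
    have "h k x = f' ((f' ^^ n) x)" unfolding n h_def int_iterate_def f'_def by (simp add: nat_add_distrib)
    moreover have "h (k + 1) x = (f' ^^ n) x" unfolding n h_def int_iterate_def f'_def by simp
    moreover have "h (k + 1) x \<in> X" using hX x by blast
    ultimately show ?thesis using f'(2) by simp
  qed
  have pre: "h (k - 1) x = f' (h k x)" if "x \<in> X" for k x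
    using suc[OF that, of "k - 1"] hX[OF that] f'(3) by simp
  have add: "h j (h k x) = h (j + k) x" if x: "x \<in> X" for j k x
  proof (induction j rule: int_induct[of _ 0])
    case base
    show ?case by (simp add: h0)
  next
    case (step1 i)
    then show ?case using suc[of "h k x" i] suc[OF x, of "i + k"] hX[OF x] by (simp add: algebra_simps)
  next
    case (step2 i)
    then show ?case using pre[of "h k x" i] pre[OF x, of "i + k"] hX[OF x] by (simp add: algebra_simps)
  qed
  \<comment> \<open>\<open>hX\<close> yields continuity only in the presence of a point of
    \<open>X\<close>.\<close>
  have "continuous_on X (h k)" for k
    using hX by (cases "X = {}") auto
  then show ?thesis
    using X hX h0 add unfolding h_def[symmetric] by unfold_locales auto
qed

theorem theorem3:
  fixes X :: "'a::metric_space set" and f g :: "'a \<Rightarrow> 'a"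
  assumes "compact X"
    and "homeomorphism X X f g"
    and "continuum_expansive X f"
  shows "tight X f"
proof -
  define h where "h = int_iterate X f"
  interpret int_action X h unfolding h_def using homeomorphism_int_action[OF assms(1,2)] .
  obtain \<epsilon> where "\<epsilon> > 0" and exp: "\<And>C. C \<subseteq> X \<Longrightarrow> continuum C \<Longrightarrow>
      (\<And>n. diameter (h n ` C) \<le> \<epsilon>) \<Longrightarrow> \<exists>x. C = {x}"
    using assms(3) unfolding continuum_expansive_def h_def by metis
  \<comment> \<open>With \<open>c = \<epsilon> / 2\<close> the locale's constant
    \<open>2 * c\<close> is the given \<open>\<epsilon>\<close>.\<close>
  interpret expansive_action X h "\<epsilon> / 2"
  proof
    show "\<exists>x. A = {x}" if A: "continuum A" "A \<subseteq> X" "\<And>k. diam_le (2 * (\<epsilon> / 2)) (h k ` A)" for A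
    proof (rule exp[OF A(2,1)])
      fix n
      \<comment> \<open>Nonemptiness makes \<open>diameter\<close> a supremum over a nonempty set,
        for which the pointwise bound suffices.\<close>
      have "A \<noteq> {}" using A(1) by (simp add: continuum_def)
      then show "diameter (h n ` A) \<le> \<epsilon>"
        using A(3)[of n] unfolding diameter_def diam_le_def by (auto intro!: cSUP_least)
    qed
  qed (use \<open>\<epsilon> > 0\<close> in simp)
  have fwd: "h (int i) = f ^^ i" and bwd: "h (- int i) = inv_into X f ^^ i" for i
    unfolding h_def int_iterate_def by auto
  have f: "continuous_on X f" "f ` X \<subseteq> X"
    using continuous[of 1] image_subset[of X 1] fwd[of 1] by auto
  have f': "continuous_on X (inv_into X f)" "inv_into X f ` X \<subseteq> X"
    using continuous[of "- 1"] image_subset[of X "- 1"] bwd[of 1] by auto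
  show ?thesis
    unfolding tight_def
  proof (intro allI impI, elim conjE)
    fix C assume C: "C \<subseteq> X" "continuum C" "nondegenerate C"
    have e: "\<epsilon> / 2 / 3 > 0" using \<open>\<epsilon> > 0\<close> by simp
    obtain N a where "N > 0" and sep:
      "(\<forall>m. \<exists>E\<subseteq>C. card E = 2 ^ m \<and> separated_within h (\<epsilon> / 2 / 3) (a + m * N) E) \<or>
       (\<forall>m. \<exists>E\<subseteq>C. card E = 2 ^ m \<and> separated_within (\<lambda>k. h (- k)) (\<epsilon> / 2 / 3) (a + m * N) E)"
      using exponentially_many_separated[OF C(2,1,3)] by blast
    from sep have "entropy X f C > 0 \<or> entropy X (inv_into X f) C > 0"
    proof
      assume "\<forall>m. \<exists>E\<subseteq>C. card E = 2 ^ m \<and> separated_within h (\<epsilon> / 2 / 3) (a + m * N) E"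
      then have "entropy X f C > 0"
        unfolding separated_within_def fwd
        by (intro entropy_pos[OF assms(1) f C(1) e \<open>N > 0\<close>]) (rule spec)
      then show ?thesis ..
    next
      assume "\<forall>m. \<exists>E\<subseteq>C. card E = 2 ^ m \<and> separated_within (\<lambda>k. h (- k)) (\<epsilon> / 2 / 3) (a + m * N) E"
      then have "entropy X (inv_into X f) C > 0"
        unfolding separated_within_def bwd
        by (intro entropy_pos[OF assms(1) f' C(1) e \<open>N > 0\<close>]) (rule spec)
      then show ?thesis ..
    qed
    then show "entropy_pm X f C > 0" unfolding entropy_pm_def by (simp add: less_max_iff_disj)
  qed
qed

end
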